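(* Let $\mathfrak A$ be an HTM, $\mathcal K$ be a $\delta$-ring, $\mathcal Q=\sigma(\mathcal K)$, $\mathcal M_0=\mathcal M_0(\mathcal K,\mathfrak A)$, and let $f$ be the map on $\mathcal M_0$ such that $f(\mu)=[\![\mu]\!]_{\mathfrak A}$ for every $\mu\in\mathcal M_0$. Then $f$ is an injective homomorphism from $\mathcal M_0$ to $\mathcal M(\mathcal Q,\mathfrak A)$ and $\operatorname{Im}f=\{\mu\in\mathcal M(\mathcal Q,\mathfrak A):\mathcal K\subset D_\mu\}$. If $\mathfrak A$ is an HCLM$_{\mathbb K}$ (for a set $\mathbb K$), then $f(k\mu)=kf(\mu)$ for every $k\in\mathbb K$ and $\mu\in\mathcal M_0$. If $\mathfrak A$ is an HOTM, then for every $\mu,\nu\in\mathcal M_0$, $f(\mu)\le f(\nu)$ if and only if $\mu\le\nu$.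
   Context: Monoids are Abelian and written additively; homomorphisms are monoid homomorphisms. An HTM is a monoid with a Hausdorff topology making addition continuous. For a map $f$, $D_f$ denotes its domain. "Countable" includes finite and empty. Given a set $\mathbb K$, an HCLM$_{\mathbb K}$ is an HTM $\mathfrak A$ endowed with a map $(k,x)\mapsto kx$ from $\mathbb K\times\mathfrak A$ to $\mathfrak A$ such that $k(x+y)=kx+ky$, $k0=0$, and $x\mapsto kx$ is continuous, for all $k\in\mathbb K$, $x,y\in\mathfrak A$. An HOTM is an HTM $\mathfrak A$ with a partial order such that $x\le y$ implies $x+z\le y+z$ for all $x,y,z$, and the set $\{(x,y)\in\mathfrak A\times\mathfrak A:x\le y\}$ is sequentially closed in $\mathfrak A\times\mathfrak A$. A ring (of sets) is a nonempty set $\mathcal Q$ of sets such that $A\cup B\in\mathcal Q$ and $A\setminus B\in\mathcal Q$ for all $A,B\in\mathcal Q$. A $\delta$-ring is a ring closed under intersections of nonempty countable families; a $\sigma$-ring is a ring closed under countable unions. For a set of sets $\mathcal K$, $\sigma(\mathcal K)$ is the smallest $\sigma$-ring containing $\mathcal K$. A family $\mathbf A\colon I\to\mathcal Q$ is a partition of $A$ (into elements of $\mathcal Q$) if $\mathbf A(i)\cap\mathbf A(j)=\varnothing$ for $i\ne j$ and $\bigcup_{i\in I}\mathbf A(i)=A$ (members may be empty and $I$ may be empty); it is countable if $I$ is countable. A family $f\colon I\to\mathfrak A$ in an HTM is summable in $\mathfrak A$ if the net $J\mapsto\sum_{i\in J}f(i)$ over the finite subsets $J\subset I$, directed by inclusion,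 converges in $\mathfrak A$; its limit is denoted $\sum f$. An $\mathfrak A$-valued premeasure is a map $\mu\colon D_\mu\to\mathfrak A$ whose domain $D_\mu$ is a $\delta$-ring and such that for every $A\in D_\mu$ and every countable partition $\mathbf A$ of $A$ into elements of $D_\mu$, the family $\mu\circ\mathbf A$ is summable in $\mathfrak A$ and $\mu(A)=\sum\mu\circ\mathbf A$. The host $\sigma$-ring of a map $\mu$ is $\mathscr H[\mu]=\sigma(D_\mu)$. Maps $\mu,\nu$ are similar, $\mu\asymp\nu$, if $\mathscr H[\mu]=\mathscr H[\nu]$ and $\mu,\nu$ coincide on $D_\mu\cap D_\nu$. An $\mathfrak A$-valued measure is an $\mathfrak A$-valued premeasure $\mu$ which is an extension of every $\mathfrak A$-valued premeasure $\nu$ with $\nu\asymp\mu$. For every $\mathfrak A$-valued premeasure $\mu$ there is a unique $\mathfrak A$-valued measure similar to $\mu$; it is denoted $[\![\mu]\!]_{\mathfrak A}$. $\mathcal M(\mathcal Q,\mathfrak A)$ is the set of all $\mathfrak A$-valued measures $\mu$ with $\mathscr H[\mu]=\mathcal Q$; it is a monoid with the addition $\mu+\nu=[\![\mu\dotplus\nu]\!]_{\mathfrak A}$, where $\mu\dotplus\nu$ is the pointwise sum defined on $D_\mu\cap D_\nu$; its neutral element is the constant map on $\mathcal Q$ with value $0$. If $\mathfrak A$ is an HCLM$_{\mathbb K}$, set $k\mu=[\![k\cdot\mu]\!]_{\mathfrak A}$ in $\mathcal M(\mathcal Q,\mathfrak A)$, where $k\cdot\mu$ is the map $A\mapsto k\mu(A)$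 on $D_\mu$. If $\mathfrak A$ is an HOTM, $\mu\le\nu$ in $\mathcal M(\mathcal Q,\mathfrak A)$ means $\mu(A)\le\nu(A)$ for all $A\in D_\mu\cap D_\nu$. $\mathcal M_0(\mathcal K,\mathfrak A)$ is the monoid of all $\mathfrak A$-valued premeasures $\mu$ with $D_\mu=\mathcal K$, with pointwise addition; if $\mathfrak A$ is an HCLM$_{\mathbb K}$, it carries the pointwise multiplication $k\mu=k\cdot\mu$; if $\mathfrak A$ is an HOTM, it carries the pointwise order. *)

theory Defs
  imports "HOL-Analysis.Analysis" "HOL-Algebra.Group"
begin

text \<open>
  A Hausdorff topological (Abelian, additive) monoid is a type of sort
  \<open>{topological_comm_monoid_add, t2_space}\<close>.  A map whose domain is a set of sets is a partial
  function \<open>'s set \<rightharpoonup> 'a\<close>, so equality of maps includes equality of domains, and ``is an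
  extension of'' is \<open>\<subseteq>\<^sub>m\<close>.
\<close>

section \<open>Rings of sets\<close>

text \<open>Rings of sets need not have a largest element, so the ambient space is \<open>UNIV\<close>.\<close>

lemma ring_of_sets_UNIV_iff:
  "ring_of_sets UNIV Q \<longleftrightarrow> Q \<noteq> {} \<and> (\<forall>A\<in>Q. \<forall>B\<in>Q. A \<union> B \<in> Q \<and> A - B \<in> Q)"
proof
  assume "ring_of_sets UNIV Q"
  then interpret ring_of_sets UNIV Q .
  show "Q \<noteq> {} \<and> (\<forall>A\<in>Q. \<forall>B\<in>Q. A \<union> B \<in> Q \<and> A - B \<in> Q)" by auto
next
  assume *: "Q \<noteq> {} \<and> (\<forall>A\<in>Q. \<forall>B\<in>Q. A \<union> B \<in> Q \<and> A - B \<in> Q)"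
  then obtain A where "A \<in> Q" by blast
  with * have "A - A \<in> Q" by blast
  with * show "ring_of_sets UNIV Q" by (intro ring_of_setsI) auto
qed

definition delta_ring :: "'s set set \<Rightarrow> bool" where
  "delta_ring Q \<longleftrightarrow> ring_of_sets UNIV Q \<and>
     (\<forall>F. F \<subseteq> Q \<and> F \<noteq> {} \<and> countable F \<longrightarrow> \<Inter>F \<in> Q)"

definition sigma_ring :: "'s set set \<Rightarrow> bool" where
  "sigma_ring Q \<longleftrightarrow> ring_of_sets UNIV Q \<and> (\<forall>F. F \<subseteq> Q \<and> countable F \<longrightarrow> \<Union>F \<in> Q)"

definition sigma_ring_gen :: "'s set set \<Rightarrow> 's set set" where
  "sigma_ring_gen K = \<Inter>{S. sigma_ring S \<and> K \<subseteq> S}"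

lemma sigma_ring_gen_least:
  "sigma_ring (sigma_ring_gen K)" "K \<subseteq> sigma_ring_gen K"
  "sigma_ring S \<Longrightarrow> K \<subseteq> S \<Longrightarrow> sigma_ring_gen K \<subseteq> S"
proof -
  have "Q \<noteq> {}" if "\<And>S. sigma_ring S \<and> K \<subseteq> S \<Longrightarrow> {} \<in> S" "Q = sigma_ring_gen K" for Q
    using that by (auto simp: sigma_ring_gen_def)
  moreover have "{} \<in> S" if "sigma_ring S" for S :: "'a set set"
    using that unfolding sigma_ring_def by (metis Union_empty countable_empty empty_subsetI)
  ultimately have "sigma_ring_gen K \<noteq> {}" by blast
  then show "sigma_ring (sigma_ring_gen K)"
    unfolding sigma_ring_def ring_of_sets_UNIV_iff sigma_ring_gen_def
    by (auto simp: subset_iff)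
qed (auto simp: sigma_ring_gen_def)

section \<open>Premeasures and measures\<close>

text \<open>
  The index set \<open>I\<close> of a countable partition is taken to be a subset of \<open>nat\<close>; by
  \<open>premeasure_countable_partition\<close> below this covers countable index sets of any type.
\<close>
definition premeasure ::
    "('s set \<rightharpoonup> 'a::{topological_comm_monoid_add, t2_space}) \<Rightarrow> bool" where
  "premeasure \<mu> \<longleftrightarrow> delta_ring (dom \<mu>) \<and>
     (\<forall>S\<in>dom \<mu>. \<forall>(I::nat set) A.
        A ` I \<subseteq> dom \<mu> \<and> disjoint_family_on A I \<and> (\<Union>i\<in>I. A i) = S \<longrightarrow>
        (\<lambda>i. the (\<mu> (A i))) summable_on I \<and>
        the (\<mu> S) = (\<Sum>\<^sub>\<infinity>i\<in>I. the (\<mu> (A i))))"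

lemma premeasure_countable_partition:
  fixes I :: "'i set"
  assumes "premeasure \<mu>" "countable I" "S \<in> dom \<mu>"
    and "A ` I \<subseteq> dom \<mu>" "disjoint_family_on A I" "(\<Union>i\<in>I. A i) = S"
  shows "(\<lambda>i. the (\<mu> (A i))) summable_on I \<and> the (\<mu> S) = (\<Sum>\<^sub>\<infinity>i\<in>I. the (\<mu> (A i)))"
proof -
  define J where "J = to_nat_on I ` I"
  define g where "g = from_nat_into I"
  have inv: "g (to_nat_on I i) = i" if "i \<in> I" for i
    using that \<open>countable I\<close> by (simp add: g_def)
  have bij: "bij_betw g J I"
    by (rule bij_betw_byWitness[where f' = "to_nat_on I"]) (auto simp: J_def inv)
  have gI: "g ` J = I" "inj_on g J" using bij by (auto simp: bij_betw_def)
  have "(\<lambda>j. A (g j)) ` J \<subseteq> dom \<mu>" "(\<Union>j\<in>J. A (g j)) = S"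
    using assms(4,6) gI(1) by auto
  moreover have "disjoint_family_on (\<lambda>j. A (g j)) J"
    using assms(5) gI unfolding disjoint_family_on_def inj_on_def by (metis imageI)
  ultimately have "(\<lambda>j. the (\<mu> (A (g j)))) summable_on J \<and>
      the (\<mu> S) = (\<Sum>\<^sub>\<infinity>j\<in>J. the (\<mu> (A (g j))))"
    using assms(1,3) unfolding premeasure_def by blast
  then show ?thesis
    using summable_on_reindex_bij_betw[OF bij, of "\<lambda>i. the (\<mu> (A i))"]
      infsum_reindex_bij_betw[OF bij, of "\<lambda>i. the (\<mu> (A i))"] by simp
qed

definition host :: "('s set \<rightharpoonup> 'a) \<Rightarrow> 's set set" where
  "host \<mu> = sigma_ring_gen (dom \<mu>)"

definition similar :: "('s set \<rightharpoonup> 'a) \<Rightarrow> ('s set \<rightharpoonup> 'a) \<Rightarrow> bool" (infix "\<asymp>" 50) where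
  "\<mu> \<asymp> \<nu> \<longleftrightarrow> host \<mu> = host \<nu> \<and> (\<forall>A\<in>dom \<mu> \<inter> dom \<nu>. \<mu> A = \<nu> A)"

definition maximal_measure ::
    "('s set \<rightharpoonup> 'a::{topological_comm_monoid_add, t2_space}) \<Rightarrow> bool" where
  "maximal_measure \<mu> \<longleftrightarrow> premeasure \<mu> \<and> (\<forall>\<nu>. premeasure \<nu> \<and> \<nu> \<asymp> \<mu> \<longrightarrow> \<nu> \<subseteq>\<^sub>m \<mu>)"

text \<open>The unique measure similar to a given premeasure.\<close>
definition induced_measure ::
    "('s set \<rightharpoonup> 'a::{topological_comm_monoid_add, t2_space}) \<Rightarrow> ('s set \<rightharpoonup> 'a)" where
  "induced_measure \<mu> = (THE \<nu>. maximal_measure \<nu> \<and> \<nu> \<asymp> \<mu>)"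

section \<open>Monoids of premeasures and of measures\<close>

definition pointwise_add :: "('s set \<rightharpoonup> 'a::plus) \<Rightarrow> ('s set \<rightharpoonup> 'a) \<Rightarrow> ('s set \<rightharpoonup> 'a)" where
  "pointwise_add \<mu> \<nu> =
     (\<lambda>A. if A \<in> dom \<mu> \<inter> dom \<nu> then Some (the (\<mu> A) + the (\<nu> A)) else None)"

definition zero_on :: "'s set set \<Rightarrow> ('s set \<rightharpoonup> 'a::zero)" where
  "zero_on Q = (\<lambda>A. if A \<in> Q then Some 0 else None)"

definition pointwise_scale :: "('k \<Rightarrow> 'a \<Rightarrow> 'a) \<Rightarrow> 'k \<Rightarrow> ('s set \<rightharpoonup> 'a) \<Rightarrow> ('s set \<rightharpoonup> 'a)" where
  "pointwise_scale sc k \<mu> = (\<lambda>A. map_option (sc k) (\<mu> A))"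

text \<open>
  This is the order of both monoids below: two premeasures with the same domain \<open>K\<close> are
  compared on all of \<open>K\<close>.
\<close>
definition pointwise_le :: "('a \<Rightarrow> 'a \<Rightarrow> bool) \<Rightarrow> ('s set \<rightharpoonup> 'a) \<Rightarrow> ('s set \<rightharpoonup> 'a) \<Rightarrow> bool" where
  "pointwise_le leq \<mu> \<nu> \<longleftrightarrow> (\<forall>A\<in>dom \<mu> \<inter> dom \<nu>. leq (the (\<mu> A)) (the (\<nu> A)))"

definition premeasure_monoid ::
    "'s set set \<Rightarrow> ('s set \<rightharpoonup> 'a::{topological_comm_monoid_add, t2_space}) monoid" where
  "premeasure_monoid K =
     \<lparr>carrier = {\<mu>. premeasure \<mu> \<and> dom \<mu> = K}, mult = pointwise_add, one = zero_on K\<rparr>"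

definition measure_monoid ::
    "'s set set \<Rightarrow> ('s set \<rightharpoonup> 'a::{topological_comm_monoid_add, t2_space}) monoid" where
  "measure_monoid Q =
     \<lparr>carrier = {\<mu>. maximal_measure \<mu> \<and> host \<mu> = Q},
      mult = (\<lambda>\<mu> \<nu>. induced_measure (pointwise_add \<mu> \<nu>)),
      one = zero_on Q\<rparr>"

definition measure_scale ::
    "('k \<Rightarrow> 'a \<Rightarrow> 'a) \<Rightarrow> 'k \<Rightarrow> ('s set \<rightharpoonup> 'a::{topological_comm_monoid_add, t2_space})
      \<Rightarrow> ('s set \<rightharpoonup> 'a)" where
  "measure_scale sc k \<mu> = induced_measure (pointwise_scale sc k \<mu>)"

text \<open>\<open>hom\<close> from HOL-Algebra does not require preservation of the neutral element.\<close>
definition monoid_hom :: "('a, 'c) monoid_scheme \<Rightarrow> ('b, 'd) monoid_scheme \<Rightarrow> ('a \<Rightarrow> 'b) set" where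
  "monoid_hom G H = {h \<in> hom G H. h \<one>\<^bsub>G\<^esub> = \<one>\<^bsub>H\<^esub>}"

section \<open>Additional structure on the value monoid\<close>

locale hclm =
  fixes \<K> :: "'k set"
    and sc :: "'k \<Rightarrow> 'a \<Rightarrow> 'a::{topological_comm_monoid_add, t2_space}"
  assumes sc_add: "k \<in> \<K> \<Longrightarrow> sc k (x + y) = sc k x + sc k y"
    and sc_zero: "k \<in> \<K> \<Longrightarrow> sc k 0 = 0"
    and sc_continuous: "k \<in> \<K> \<Longrightarrow> continuous_on UNIV (sc k)"

locale hotm =
  fixes leq :: "'a \<Rightarrow> 'a::{topological_comm_monoid_add, t2_space} \<Rightarrow> bool"
  assumes le_refl: "reflp leq"
    and le_trans: "transp leq"
    and le_antisym: "antisymp leq"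
    and le_add_right: "leq x y \<Longrightarrow> leq (x + z) (y + z)"
    and le_seq_closed: "(\<And>n. X n \<in> {(x, y). leq x y}) \<Longrightarrow> X \<longlonglongrightarrow> l \<Longrightarrow> l \<in> {(x, y). leq x y}"

end

theory Submission
  imports Defs
begin

text \<open>
  A \<open>\<delta>\<close>-ring \<open>K\<close> is an ideal in \<open>\<sigma>(K)\<close>, and every element of \<open>\<sigma>(K)\<close> is a countable disjoint
  union of elements of \<open>K\<close>.  Hence two premeasures with the same host agree wherever both are
  defined as soon as they agree on some \<open>\<delta>\<close>-ring generating that host, and similarity is transitive.
  The measure induced by \<open>\<mu>\<close> is the union of all premeasures similar to \<open>\<mu>\<close>: this family is
  directed, because similar \<open>\<mu>\<close> and \<open>\<nu>\<close> extend jointly to \<open>A \<union> B \<mapsto> \<mu> A + \<nu> B\<close> for disjoint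
  \<open>A\<close>, \<open>B\<close>, and by the ideal property a partition of a set from one of the domains stays inside
  that domain.  No iterated sums occur, so the value monoid need not be regular.
\<close>

section \<open>Delta-rings and the sigma-rings they generate\<close>

lemma delta_ring_Un: "delta_ring K \<Longrightarrow> A \<in> K \<Longrightarrow> B \<in> K \<Longrightarrow> A \<union> B \<in> K"
  and delta_ring_Diff: "delta_ring K \<Longrightarrow> A \<in> K \<Longrightarrow> B \<in> K \<Longrightarrow> A - B \<in> K"
  by (auto simp: delta_ring_def ring_of_sets_UNIV_iff)

lemma delta_ring_empty: "delta_ring K \<Longrightarrow> {} \<in> K"
  unfolding delta_ring_def ring_of_sets_UNIV_iff by (metis Diff_cancel ex_in_conv)

text \<open>By De Morgan, \<open>A - \<Union>F\<close> is the intersection of the countably many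
  differences \<open>A - X\<close> for \<open>X\<close> in \<open>F\<close>. Adding
  \<open>{}\<close> to \<open>F\<close> keeps the family nonempty, as closure of a \<delta>-ring
  under intersections requires.\<close>

lemma delta_ring_Diff_Union:
  assumes "delta_ring K" "A \<in> K" "F \<subseteq> K" "countable F"
  shows "A - \<Union>F \<in> K"
proof -
  have "(-) A ` insert {} F \<subseteq> K"
    using assms(2,3) delta_ring_Diff[OF assms(1,2)] by auto
  then have "\<Inter>((-) A ` insert {} F) \<in> K"
    using assms(1,4) unfolding delta_ring_def
    by (meson countable_image countable_insert image_is_empty insert_not_empty)
  moreover have "\<Inter>((-) A ` insert {} F) = A - \<Union>F" by auto
  ultimately show ?thesis by simp
qed

lemma delta_ring_Int:
  assumes "delta_ring K" "delta_ring L"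
  shows "delta_ring (K \<inter> L)"
proof -
  have "K \<inter> L \<noteq> {}" using assms delta_ring_empty by blast
  then show ?thesis
    using assms unfolding delta_ring_def ring_of_sets_UNIV_iff by (simp add: le_infI1)
qed

lemma sigma_ring_Un: "sigma_ring Q \<Longrightarrow> A \<in> Q \<Longrightarrow> B \<in> Q \<Longrightarrow> A \<union> B \<in> Q"
  and sigma_ring_Diff: "sigma_ring Q \<Longrightarrow> A \<in> Q \<Longrightarrow> B \<in> Q \<Longrightarrow> A - B \<in> Q"
  and sigma_ring_Union: "sigma_ring Q \<Longrightarrow> F \<subseteq> Q \<Longrightarrow> countable F \<Longrightarrow> \<Union>F \<in> Q"
  by (auto simp: sigma_ring_def ring_of_sets_UNIV_iff)

lemma sigma_ring_Inter:
  assumes "sigma_ring Q" "F \<subseteq> Q" "F \<noteq> {}" "countable F"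
  shows "\<Inter>F \<in> Q"
proof -
  obtain A where A: "A \<in> F" using assms(3) by blast
  then have "(-) A ` F \<subseteq> Q" using assms(1,2) sigma_ring_Diff by blast
  then have "A - \<Union>((-) A ` F) \<in> Q"
    using assms A by (intro sigma_ring_Diff sigma_ring_Union) auto
  moreover have "A - \<Union>((-) A ` F) = \<Inter>F" using A by auto
  ultimately show ?thesis by simp
qed

lemma sigma_ring_Int: "sigma_ring Q \<Longrightarrow> A \<in> Q \<Longrightarrow> B \<in> Q \<Longrightarrow> A \<inter> B \<in> Q"
  using sigma_ring_Inter[of Q "{A, B}"] by simp

text \<open>Differences and countable intersections have the form \<open>A \<inter> Y\<close> with
  \<open>A\<close> in \<open>D\<close> and \<open>Y\<close> in \<open>Q\<close>, so the ideal
  property supplies them. This reduces the \<delta>-ring property of the enlarged domains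
  constructed later to closure under unions.\<close>

lemma delta_ring_ideal:
  assumes "sigma_ring Q" "D \<subseteq> Q" "D \<noteq> {}"
    and Un: "\<And>A B. A \<in> D \<Longrightarrow> B \<in> D \<Longrightarrow> A \<union> B \<in> D"
    and ideal: "\<And>A B. A \<in> D \<Longrightarrow> B \<in> Q \<Longrightarrow> A \<inter> B \<in> D"
  shows "delta_ring D"
  unfolding delta_ring_def ring_of_sets_UNIV_iff
proof (intro conjI ballI allI impI; (elim conjE)?)
  fix A B assume AB: "A \<in> D" "B \<in> D"
  have "A \<inter> (A - B) \<in> D"
    using AB assms(2) by (intro ideal sigma_ring_Diff[OF assms(1)]) auto
  then show "A - B \<in> D" by (simp add: Int_absorb1)
next
  fix F assume F: "F \<subseteq> D" "F \<noteq> {}" "countable F"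
  then obtain A where "A \<in> F" by blast
  moreover from this have "A \<inter> \<Inter>F \<in> D"
    using F assms(2) by (intro ideal sigma_ring_Inter[OF assms(1)]) auto
  ultimately show "\<Inter>F \<in> D" by (simp add: Inter_lower Int_absorb1)
qed (use assms in auto)

lemma sigma_ring_imp_delta_ring: "sigma_ring Q \<Longrightarrow> delta_ring Q"
  by (rule delta_ring_ideal[where Q = Q])
    (auto simp: sigma_ring_def ring_of_sets_UNIV_iff intro: sigma_ring_Int)

lemma sigma_ring_gen_idem: "sigma_ring Q \<Longrightarrow> sigma_ring_gen Q = Q"
  using sigma_ring_gen_least by blast

text \<open>The countable unions of elements of \<open>K\<close> already form a \<sigma>-ring. The
  delicate point is differences: subtracting a countable union \<open>B\<close> from
  \<open>\<Union>F\<close> gives the union of the sets \<open>X - B\<close> with \<open>X\<close> in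
  \<open>F\<close>, and each of these lies in \<open>K\<close> by
  \<open>delta_ring_Diff_Union\<close>.\<close>

lemma sigma_ring_gen_delta_ring_subset:
  assumes "delta_ring K" "S \<in> sigma_ring_gen K"
  obtains F where "F \<subseteq> K" "countable F" "S = \<Union>F"
proof -
  define U where "U = {\<Union>F | F. F \<subseteq> K \<and> countable F}"
  have Union: "\<Union>G \<in> U" if "G \<subseteq> U" "countable G" for G
  proof -
    have "\<forall>A\<in>G. \<exists>F. F \<subseteq> K \<and> countable F \<and> A = \<Union>F"
      using that(1) by (auto simp: U_def)
    \<comment> \<open>One countable cover is chosen for each member of \<open>G\<close>, so that a
      countable union of countable unions becomes a single one.\<close>
    from bchoice[OF this] obtain h
      where h: "\<forall>A\<in>G. h A \<subseteq> K \<and> countable (h A) \<and> A = \<Union>(h A)" ..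
    have "\<Union>(h ` G) \<subseteq> K" "countable (\<Union>(h ` G))"
      using h that(2) by auto
    moreover have "\<Union>(\<Union>(h ` G)) = (\<Union>A\<in>G. \<Union>(h A))" by blast
    then have "\<Union>G = \<Union>(\<Union>(h ` G))" using h by simp
    ultimately show ?thesis unfolding U_def by blast
  qed
  have "sigma_ring U"
    unfolding sigma_ring_def ring_of_sets_UNIV_iff
  proof (intro conjI ballI allI impI; (elim conjE)?)
    show "U \<noteq> {}" by (auto simp: U_def)
    fix A B assume AB: "A \<in> U" "B \<in> U"
    then show "A \<union> B \<in> U" using Union[of "{A, B}"] by simp
    from AB obtain F G where F: "F \<subseteq> K" "countable F" "A = \<Union>F"
      and G: "G \<subseteq> K" "countable G" "B = \<Union>G"
      by (auto simp: U_def)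
    have "(\<lambda>X. X - B) ` F \<subseteq> K"
      using F delta_ring_Diff_Union[OF assms(1) _ G(1,2)] G(3) by auto
    moreover have "A - B = \<Union>((\<lambda>X. X - B) ` F)" using F(3) by auto
    ultimately show "A - B \<in> U" using F(2) unfolding U_def by blast
  qed (use Union in auto)
  moreover have "K \<subseteq> U"
  proof
    fix A assume "A \<in> K"
    then have "{A} \<subseteq> K \<and> countable {A} \<and> A = \<Union>{A}" by simp
    then show "A \<in> U" unfolding U_def by blast
  qed
  ultimately have "S \<in> U" using assms(2) sigma_ring_gen_least(3) by blast
  then show thesis using that by (auto simp: U_def)
qed

text \<open>This is the ideal property. Although \<open>B\<close> may be outside \<open>K\<close>,
  the difference \<open>A - B\<close> is in \<open>K\<close> because \<open>B\<close> is a countable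
  union of elements of \<open>K\<close>, and \<open>A \<inter> B = A - (A - B)\<close>.\<close>

lemma delta_ring_Int_sigma_ring_gen:
  assumes "delta_ring K" "A \<in> K" "B \<in> sigma_ring_gen K"
  shows "A \<inter> B \<in> K"
proof -
  obtain F where F: "F \<subseteq> K" "countable F" "B = \<Union>F"
    using sigma_ring_gen_delta_ring_subset[OF assms(1,3)] .
  have "A - B \<in> K" unfolding F(3) by (rule delta_ring_Diff_Union[OF assms(1,2) F(1,2)])
  then have "A - (A - B) \<in> K" by (rule delta_ring_Diff[OF assms(1,2)])
  then show ?thesis by (simp add: Diff_Diff_Int)
qed

lemma delta_ring_subset_mem:
  assumes "delta_ring K" "A \<in> K" "B \<in> sigma_ring_gen K" "B \<subseteq> A"
  shows "B \<in> K"
  using delta_ring_Int_sigma_ring_gen[OF assms(1-3)] assms(4) by (simp add: Int_absorb1)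

lemma delta_ring_disjoint_cover:
  assumes K: "delta_ring K" and S: "S \<in> sigma_ring_gen K"
  obtains A :: "nat \<Rightarrow> _" where "range A \<subseteq> K" "disjoint_family A" "(\<Union>n. A n) = S"
proof -
  obtain F where F: "F \<subseteq> K" "countable F" "S = \<Union>F"
    using sigma_ring_gen_delta_ring_subset[OF assms] .
  \<comment> \<open>Inserting \<open>{}\<close> makes the enumerated set nonempty, so that
    \<open>F = {}\<close> needs no separate treatment.\<close>
  define B where "B = from_nat_into (insert {} F)"
  have B: "range B = insert {} F" using F(2) by (simp add: B_def range_from_nat_into)
  have "range (disjointed B) \<subseteq> K"
    using K F(1) delta_ring_empty[OF K] unfolding B delta_ring_def
    by (intro ring_of_sets.range_disjointed_sets[where \<Omega> = UNIV]) (auto simp: B)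
  moreover have "(\<Union>n. disjointed B n) = S"
    using F(3) B by (simp add: UN_disjointed_eq)
  ultimately show thesis using that disjoint_family_disjointed by blast
qed

text \<open>An element \<open>A\<close> of \<open>K\<close> is a countable union of elements of
  \<open>L\<close>. These are subsets of \<open>A\<close> in the common \<sigma>-ring, hence in
  \<open>K\<close> by the ideal property. So \<open>K \<inter> L\<close> still generates the whole
  \<sigma>-ring, and the disjoint cover can be taken from it.\<close>

lemma delta_ring_Int_cover:
  assumes K: "delta_ring K" and L: "delta_ring L" and eq: "sigma_ring_gen K = sigma_ring_gen L"
    and S: "S \<in> sigma_ring_gen K"
  obtains A :: "nat \<Rightarrow> _" where "range A \<subseteq> K \<inter> L" "disjoint_family A" "(\<Union>n. A n) = S"
proof -
  have KQ: "K \<subseteq> sigma_ring_gen K" and LQ: "L \<subseteq> sigma_ring_gen K"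
    using sigma_ring_gen_least(2) eq by auto
  have "A \<in> sigma_ring_gen (K \<inter> L)" if "A \<in> K" for A
  proof -
    have "A \<in> sigma_ring_gen L" using that KQ eq by auto
    then obtain F where F: "F \<subseteq> L" "countable F" "A = \<Union>F"
      using sigma_ring_gen_delta_ring_subset[OF L] by blast
    have "X \<in> K" if "X \<in> F" for X
      using delta_ring_subset_mem[OF K \<open>A \<in> K\<close>, of X] that F LQ by auto
    then have "F \<subseteq> sigma_ring_gen (K \<inter> L)"
      using F sigma_ring_gen_least(2)[of "K \<inter> L"] by auto
    then show ?thesis using F sigma_ring_Union[OF sigma_ring_gen_least(1)] by metis
  qed
  then have "sigma_ring_gen K \<subseteq> sigma_ring_gen (K \<inter> L)"
    by (intro sigma_ring_gen_least) auto
  then show thesis using delta_ring_disjoint_cover[OF delta_ring_Int[OF K L]] S that by blast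
qed

text \<open>Ensures that a pointwise sum, defined only on the intersection of two domains, keeps the
  host.\<close>

lemma sigma_ring_gen_Int:
  assumes K: "delta_ring K" and L: "delta_ring L" and eq: "sigma_ring_gen K = sigma_ring_gen L"
  shows "sigma_ring_gen (K \<inter> L) = sigma_ring_gen K"
proof
  show "sigma_ring_gen (K \<inter> L) \<subseteq> sigma_ring_gen K"
    using sigma_ring_gen_least(2)[of K] by (intro sigma_ring_gen_least) auto
  show "sigma_ring_gen K \<subseteq> sigma_ring_gen (K \<inter> L)"
  proof
    fix S assume "S \<in> sigma_ring_gen K"
    then obtain A :: "nat \<Rightarrow> _" where "range A \<subseteq> K \<inter> L" "(\<Union>n. A n) = S"
      using delta_ring_Int_cover[OF K L eq] by metis
    then show "S \<in> sigma_ring_gen (K \<inter> L)"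
      using sigma_ring_gen_least(2)[of "K \<inter> L"]
        sigma_ring_Union[OF sigma_ring_gen_least(1)[of "K \<inter> L"], of "range A"] by auto
  qed
qed

section \<open>Premeasures\<close>

text \<open>Limits in a Hausdorff space are unique, so summability together with the value of
  \<open>infsum\<close> is the single relation \<open>has_sum\<close>, which avoids the default
  value of \<open>infsum\<close> on families that are not summable.\<close>

lemma premeasure_iff_has_sum:
  "premeasure \<mu> \<longleftrightarrow> delta_ring (dom \<mu>) \<and>
     (\<forall>(I::nat set) A. A ` I \<subseteq> dom \<mu> \<and> disjoint_family_on A I \<and> (\<Union>i\<in>I. A i) \<in> dom \<mu> \<longrightarrow>
        ((\<lambda>i. the (\<mu> (A i))) has_sum the (\<mu> (\<Union>i\<in>I. A i))) I)"
proof -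
  have "g summable_on I \<and> x = infsum g I \<longleftrightarrow> (g has_sum x) I" for g x and I :: "nat set"
    by (auto simp: infsumI dest: has_sum_imp_summable)
  then show ?thesis unfolding premeasure_def by metis
qed

lemma premeasureI:
  assumes "delta_ring (dom \<mu>)"
    and "\<And>(I::nat set) A. A ` I \<subseteq> dom \<mu> \<Longrightarrow> disjoint_family_on A I \<Longrightarrow> (\<Union>i\<in>I. A i) \<in> dom \<mu> \<Longrightarrow>
        ((\<lambda>i. the (\<mu> (A i))) has_sum the (\<mu> (\<Union>i\<in>I. A i))) I"
  shows "premeasure \<mu>"
  using assms unfolding premeasure_iff_has_sum by simp

lemma premeasure_delta_ring: "premeasure \<mu> \<Longrightarrow> delta_ring (dom \<mu>)"
  by (simp add: premeasure_def)

lemma premeasure_has_sum: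
  fixes I :: "nat set"
  assumes "premeasure \<mu>" "A ` I \<subseteq> dom \<mu>" "disjoint_family_on A I" "(\<Union>i\<in>I. A i) = S" "S \<in> dom \<mu>"
  shows "((\<lambda>i. the (\<mu> (A i))) has_sum the (\<mu> S)) I"
  unfolding assms(4)[symmetric]
  by (rule assms(1)[unfolded premeasure_iff_has_sum, THEN conjunct2, rule_format])
    (use assms in simp)

lemma premeasure_empty:
  assumes "premeasure \<mu>"
  shows "the (\<mu> {}) = 0"
proof -
  \<comment> \<open>The monoid need not be cancellative, so the value at \<open>{}\<close> is read
    off from the partition with empty index set, whose sum is 0.\<close>
  have "((\<lambda>i. the (\<mu> {})) has_sum the (\<mu> {})) ({} :: nat set)"
    by (rule premeasure_has_sum[OF assms])
      (auto simp: disjoint_family_on_def domIff[symmetric]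
        delta_ring_empty[OF premeasure_delta_ring[OF assms]] simp del: domIff)
  then show ?thesis using has_sum_unique[OF _ has_sum_finiteI] by fastforce
qed

lemma premeasure_Un:
  assumes "premeasure \<mu>" "A \<in> dom \<mu>" "B \<in> dom \<mu>" "A \<inter> B = {}"
  shows "the (\<mu> (A \<union> B)) = the (\<mu> A) + the (\<mu> B)"
proof -
  define C where "C i = (if i = 0 then A else B)" for i :: nat
  have "((\<lambda>i. the (\<mu> (C i))) has_sum the (\<mu> (A \<union> B))) {0, 1}"
    using assms delta_ring_Un[OF premeasure_delta_ring[OF assms(1)] assms(2,3)]
    by (intro premeasure_has_sum) (auto simp: C_def disjoint_family_on_def)
  moreover have "((\<lambda>i. the (\<mu> (C i))) has_sum (the (\<mu> A) + the (\<mu> B))) {0, 1}"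
    by (rule has_sum_finiteI) (simp_all add: C_def)
  ultimately show ?thesis by (rule has_sum_unique)
qed

lemma dom_subset_host: "dom \<mu> \<subseteq> host \<mu>"
  and sigma_ring_host: "sigma_ring (host \<mu>)"
  by (simp_all add: host_def sigma_ring_gen_least)

lemma host_subset_mono: "dom \<mu> \<subseteq> host \<nu> \<Longrightarrow> host \<mu> \<subseteq> host \<nu>"
  by (simp add: host_def sigma_ring_gen_least)

lemma premeasure_Int: "premeasure \<mu> \<Longrightarrow> A \<in> dom \<mu> \<Longrightarrow> B \<in> host \<mu> \<Longrightarrow> A \<inter> B \<in> dom \<mu>"
  unfolding host_def by (rule delta_ring_Int_sigma_ring_gen[OF premeasure_delta_ring])

lemma premeasure_subset_mem:
  "premeasure \<mu> \<Longrightarrow> A \<in> dom \<mu> \<Longrightarrow> B \<in> host \<mu> \<Longrightarrow> B \<subseteq> A \<Longrightarrow> B \<in> dom \<mu>"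
  using premeasure_Int[of \<mu> A B] by (simp add: Int_absorb1)

section \<open>Restrictions, sums, zero maps and multiples of premeasures\<close>

lemma premeasure_restrict:
  assumes "premeasure \<mu>" "delta_ring K" "K \<subseteq> dom \<mu>"
  shows "premeasure (\<mu> |` K)"
proof (rule premeasureI)
  have dom: "dom (\<mu> |` K) = K" using assms(3) by auto
  then show "delta_ring (dom (\<mu> |` K))" using assms(2) by simp
  fix I :: "nat set" and A
  assume *: "A ` I \<subseteq> dom (\<mu> |` K)" "disjoint_family_on A I" "(\<Union>i\<in>I. A i) \<in> dom (\<mu> |` K)"
  then have "((\<lambda>i. the (\<mu> (A i))) has_sum the (\<mu> (\<Union>i\<in>I. A i))) I"
    using assms(3) dom by (intro premeasure_has_sum[OF assms(1)]) auto
  then have "((\<lambda>i. the ((\<mu> |` K) (A i))) has_sum the (\<mu> (\<Union>i\<in>I. A i))) I"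
    using * unfolding dom by (subst has_sum_cong[where g = "\<lambda>i. the (\<mu> (A i))"]) auto
  then show "((\<lambda>i. the ((\<mu> |` K) (A i))) has_sum the ((\<mu> |` K) (\<Union>i\<in>I. A i))) I"
    using * unfolding dom by simp
qed

lemma dom_pointwise_add: "dom (pointwise_add \<mu> \<nu>) = dom \<mu> \<inter> dom \<nu>"
  by (auto simp: pointwise_add_def split: if_splits)

lemma premeasure_pointwise_add:
  assumes "premeasure \<mu>" "premeasure \<nu>" "host \<mu> = host \<nu>"
  shows "premeasure (pointwise_add \<mu> \<nu>)"
proof (rule premeasureI, unfold dom_pointwise_add)
  show "delta_ring (dom \<mu> \<inter> dom \<nu>)"
    using assms by (simp add: delta_ring_Int premeasure_delta_ring host_def)
  fix I :: "nat set" and A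
  assume *: "A ` I \<subseteq> dom \<mu> \<inter> dom \<nu>" "disjoint_family_on A I" "(\<Union>i\<in>I. A i) \<in> dom \<mu> \<inter> dom \<nu>"
  then have "((\<lambda>i. the (\<mu> (A i)) + the (\<nu> (A i))) has_sum
      the (\<mu> (\<Union>i\<in>I. A i)) + the (\<nu> (\<Union>i\<in>I. A i))) I"
    using assms by (intro has_sum_add premeasure_has_sum) auto
  moreover have val: "the (pointwise_add \<mu> \<nu> X) = the (\<mu> X) + the (\<nu> X)"
    if "X \<in> dom \<mu> \<inter> dom \<nu>" for X
    using that by (simp add: pointwise_add_def)
  ultimately show "((\<lambda>i. the (pointwise_add \<mu> \<nu> (A i))) has_sum
      the (pointwise_add \<mu> \<nu> (\<Union>i\<in>I. A i))) I"
    using *(1) unfolding val[OF *(3)] by (simp add: val image_subset_iff cong: has_sum_cong)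
qed

lemma host_pointwise_add:
  assumes "premeasure \<mu>" "premeasure \<nu>" "host \<mu> = host \<nu>"
  shows "host (pointwise_add \<mu> \<nu>) = host \<mu>"
  using assms unfolding host_def dom_pointwise_add
  by (intro sigma_ring_gen_Int premeasure_delta_ring) auto

lemma dom_zero_on: "dom (zero_on Q) = Q"
  by (auto simp: zero_on_def split: if_splits)

lemma premeasure_zero_on:
  assumes "delta_ring K"
  shows "premeasure (zero_on K)"
proof (rule premeasureI, unfold dom_zero_on)
  fix I :: "nat set" and A :: "nat \<Rightarrow> 'a set"
  assume *: "A ` I \<subseteq> K" "(\<Union>i\<in>I. A i) \<in> K"
  have val: "the (zero_on K X) = 0" if "X \<in> K" for X :: "'a set"
    using that by (simp add: zero_on_def)
  show "((\<lambda>i. the (zero_on K (A i))) has_sum the (zero_on K (\<Union>i\<in>I. A i))) I"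
    unfolding val[OF *(2)] using *(1) by (intro has_sum_0 val) auto
qed (rule assms)

lemma dom_pointwise_scale: "dom (pointwise_scale sc k \<mu>) = dom \<mu>"
  by (auto simp: pointwise_scale_def)

lemma host_pointwise_scale: "host (pointwise_scale sc k \<mu>) = host \<mu>"
  by (simp add: host_def dom_pointwise_scale)

lemma (in hclm) premeasure_pointwise_scale:
  assumes k: "k \<in> \<K>" and \<mu>: "premeasure \<mu>"
  shows "premeasure (pointwise_scale sc k \<mu>)"
proof (rule premeasureI, unfold dom_pointwise_scale)
  show "delta_ring (dom \<mu>)" by (rule premeasure_delta_ring[OF \<mu>])
  fix I :: "nat set" and A
  assume *: "A ` I \<subseteq> dom \<mu>" "disjoint_family_on A I" "(\<Union>i\<in>I. A i) \<in> dom \<mu>"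
  have val: "the (pointwise_scale sc k \<mu> X) = sc k (the (\<mu> X))" if "X \<in> dom \<mu>" for X
    using that by (auto simp: pointwise_scale_def)
  \<comment> \<open>Preservation of 0 settles the empty sum. Continuity then carries
    \<open>sc k\<close> through the limit over finite subsets.\<close>
  have fin: "sum (sc k \<circ> g) F = sc k (sum g F)" if "finite F" for F :: "nat set" and g
    using that by induction (simp_all add: sc_zero[OF k] sc_add[OF k])
  have "((\<lambda>i. the (\<mu> (A i))) has_sum the (\<mu> (\<Union>i\<in>I. A i))) I"
    using * by (intro premeasure_has_sum[OF \<mu>]) auto
  then have "(sc k \<circ> (\<lambda>i. the (\<mu> (A i))) has_sum sc k (the (\<mu> (\<Union>i\<in>I. A i)))) I"
    using sc_continuous[OF k] fin
    by (intro has_sum_comm_additive_general) (auto simp: continuous_on_def)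
  then show "((\<lambda>i. the (pointwise_scale sc k \<mu> (A i))) has_sum
      the (pointwise_scale sc k \<mu> (\<Union>i\<in>I. A i))) I"
    using *(1) unfolding val[OF *(3)]
    by (simp add: val image_subset_iff comp_def cong: has_sum_cong)
qed

section \<open>Similarity\<close>

lemma similar_refl: "\<mu> \<asymp> \<mu>"
  and similar_sym: "\<mu> \<asymp> \<nu> \<Longrightarrow> \<nu> \<asymp> \<mu>"
  by (auto simp: similar_def)

lemma similar_host: "\<mu> \<asymp> \<nu> \<Longrightarrow> host \<mu> = host \<nu>"
  and similar_eq: "\<mu> \<asymp> \<nu> \<Longrightarrow> A \<in> dom \<mu> \<Longrightarrow> A \<in> dom \<nu> \<Longrightarrow> \<mu> A = \<nu> A"
  by (auto simp: similar_def)

text \<open>The middle map \<nu> may be undefined at \<open>S\<close>, so \<open>S\<close> is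
  partitioned into elements of \<open>dom \<nu>\<close>. By the ideal property these lie in all
  three domains, where the maps agree; hence \<mu> and \<rho> assign to \<open>S\<close> the sum of
  the same family.\<close>

lemma similar_trans:
  assumes pre: "premeasure \<mu>" "premeasure \<nu>" "premeasure \<rho>"
    and "\<mu> \<asymp> \<nu>" "\<nu> \<asymp> \<rho>"
  shows "\<mu> \<asymp> \<rho>"
  unfolding similar_def
proof (intro conjI ballI)
  show "host \<mu> = host \<rho>" using assms(4,5) by (simp add: similar_def)
  fix S assume S: "S \<in> dom \<mu> \<inter> dom \<rho>"
  have hosts: "host \<mu> = host \<nu>" "host \<rho> = host \<nu>"
    using similar_host assms(4,5) by metis+
  have "S \<in> host \<nu>" using S hosts dom_subset_host[of \<mu>] by auto
  then obtain A :: "nat \<Rightarrow> _" where A: "range A \<subseteq> dom \<nu>" "disjoint_family A" "(\<Union>n. A n) = S"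
    using delta_ring_disjoint_cover[OF premeasure_delta_ring[OF pre(2)]] unfolding host_def by metis
  have An: "A n \<in> dom \<mu>" "A n \<in> dom \<nu>" "A n \<in> dom \<rho>" for n
  proof -
    show \<nu>: "A n \<in> dom \<nu>" using A(1) by auto
    then have "A n \<in> host \<nu>" "A n \<subseteq> S" using dom_subset_host[of \<nu>] A(3) by auto
    then show "A n \<in> dom \<mu>" "A n \<in> dom \<rho>"
      using S hosts premeasure_subset_mem pre by (metis IntE)+
  qed
  have "((\<lambda>n. the (\<mu> (A n))) has_sum the (\<mu> S)) UNIV"
    using An A S by (intro premeasure_has_sum[OF pre(1)]) auto
  moreover have "\<mu> (A n) = \<rho> (A n)" for n
    using An similar_eq assms(4,5) by metis
  moreover have "((\<lambda>n. the (\<rho> (A n))) has_sum the (\<rho> S)) UNIV"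
    using An A S by (intro premeasure_has_sum[OF pre(3)]) auto
  ultimately have "the (\<mu> S) = the (\<rho> S)" by (simp add: has_sum_unique)
  then show "\<mu> S = \<rho> S" using S by auto
qed

lemma similar_map_le: "\<mu> \<subseteq>\<^sub>m \<nu> \<Longrightarrow> host \<mu> = host \<nu> \<Longrightarrow> \<mu> \<asymp> \<nu>"
  by (auto simp: similar_def map_le_def)

text \<open>Allows summands to be replaced by their induced measures without leaving the similarity
  class of the sum.\<close>

lemma similar_pointwise_add:
  assumes "premeasure \<mu>" "premeasure \<nu>" "premeasure \<mu>'" "premeasure \<nu>'"
    and "\<mu> \<asymp> \<mu>'" "\<nu> \<asymp> \<nu>'" "host \<mu> = host \<nu>"
  shows "pointwise_add \<mu> \<nu> \<asymp> pointwise_add \<mu>' \<nu>'"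
  unfolding similar_def dom_pointwise_add
proof (intro conjI ballI)
  show "host (pointwise_add \<mu> \<nu>) = host (pointwise_add \<mu>' \<nu>')"
    using assms by (simp add: host_pointwise_add similar_host)
qed (use similar_eq[OF assms(5)] similar_eq[OF assms(6)] in \<open>auto simp: pointwise_add_def\<close>)

lemma similar_pointwise_scale:
  assumes "\<mu> \<asymp> \<nu>"
  shows "pointwise_scale sc k \<mu> \<asymp> pointwise_scale sc k \<nu>"
  using assms unfolding similar_def dom_pointwise_scale host_pointwise_scale
  by (simp add: pointwise_scale_def)

text \<open>Supplies the upper bounds that make the premeasures similar to a given one a directed
  family; closure under unions in \<open>maximal_measure_exists\<close> rests on it.\<close>

lemma premeasure_join:
  assumes \<mu>: "premeasure \<mu>" and \<nu>: "premeasure \<nu>" and sim: "\<mu> \<asymp> \<nu>"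
  obtains \<rho> where "premeasure \<rho>" "\<mu> \<subseteq>\<^sub>m \<rho>" "\<nu> \<subseteq>\<^sub>m \<rho>" "host \<rho> = host \<mu>"
proof -
  define D where "D = {A \<union> B | A B. A \<in> dom \<mu> \<and> B \<in> dom \<nu>}"
  define P where "P C x \<longleftrightarrow> (\<exists>A B. A \<in> dom \<mu> \<and> B \<in> dom \<nu> \<and> A \<inter> B = {} \<and> C = A \<union> B \<and>
    x = the (\<mu> A) + the (\<nu> B))" for C x
  define \<rho> where "\<rho> C = (if C \<in> D then Some (THE x. P C x) else None)" for C
  have dom: "dom \<rho> = D" by (auto simp: \<rho>_def split: if_splits)
  have host: "host \<nu> = host \<mu>" using similar_host[OF sim] by simp
  have \<mu>Int: "A \<inter> B \<in> dom \<mu>" if "A \<in> dom \<mu>" "B \<in> host \<mu>" for A B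
    using that premeasure_Int[OF \<mu>] by simp
  have \<nu>Int: "A \<inter> B \<in> dom \<nu>" if "A \<in> dom \<nu>" "B \<in> host \<mu>" for A B
    using that premeasure_Int[OF \<nu>] by (simp add: host)
  have sub: "dom \<mu> \<subseteq> host \<mu>" "dom \<nu> \<subseteq> host \<mu>"
    using dom_subset_host[of \<mu>] dom_subset_host[of \<nu>] host by auto
  have split: "the (\<mu> A) = the (\<mu> (A \<inter> A')) + the (\<mu> (A \<inter> B'))"
    if "A \<in> dom \<mu>" "A' \<in> host \<mu>" "B' \<in> host \<mu>" "A' \<inter> B' = {}" "A \<subseteq> A' \<union> B'" for A A' B'
  proof -
    have "A = (A \<inter> A') \<union> (A \<inter> B')" using that(5) by blast
    then show ?thesis
      using premeasure_Un[OF \<mu>, of "A \<inter> A'" "A \<inter> B'"] \<mu>Int[OF that(1)] that by auto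
  qed
  have split': "the (\<nu> B) = the (\<nu> (B \<inter> A')) + the (\<nu> (B \<inter> B'))"
    if "B \<in> dom \<nu>" "A' \<in> host \<mu>" "B' \<in> host \<mu>" "A' \<inter> B' = {}" "B \<subseteq> A' \<union> B'" for B A' B'
  proof -
    have "B = (B \<inter> A') \<union> (B \<inter> B')" using that(5) by blast
    then show ?thesis
      using premeasure_Un[OF \<nu>, of "B \<inter> A'" "B \<inter> B'"] \<nu>Int[OF that(1)] that by auto
  qed
  \<comment> \<open>Two decompositions of \<open>C\<close> have the four pairwise intersections as a
    common refinement. The mixed pieces \<open>A \<inter> B'\<close> and
    \<open>A' \<inter> B\<close> lie in both domains, where \<mu> and \<nu> coincide. Both values
    are therefore the same sum of four terms, with no cancellation involved.\<close>
  have uniq: "x = y" if "P C x" "P C y" for C x y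
  proof -
    from that obtain A B A' B' where
      AB: "A \<in> dom \<mu>" "B \<in> dom \<nu>" "A \<inter> B = {}" "C = A \<union> B" "x = the (\<mu> A) + the (\<nu> B)" and
      AB': "A' \<in> dom \<mu>" "B' \<in> dom \<nu>" "A' \<inter> B' = {}" "C = A' \<union> B'" "y = the (\<mu> A') + the (\<nu> B')"
      unfolding P_def by blast
    have h: "A \<in> host \<mu>" "B \<in> host \<mu>" "A' \<in> host \<mu>" "B' \<in> host \<mu>"
      using AB AB' sub by auto
    have 1: "\<mu> (A \<inter> B') = \<nu> (A \<inter> B')"
      using \<mu>Int[OF AB(1) h(4)] \<nu>Int[OF AB'(2) h(1)] by (intro similar_eq[OF sim]) (auto simp: Int_commute)
    have 2: "\<mu> (A' \<inter> B) = \<nu> (A' \<inter> B)"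
      using \<mu>Int[OF AB'(1) h(2)] \<nu>Int[OF AB(2) h(3)] by (intro similar_eq[OF sim]) (auto simp: Int_commute)
    have "the (\<mu> A) = the (\<mu> (A \<inter> A')) + the (\<mu> (A \<inter> B'))"
      using AB AB' h by (intro split) auto
    moreover have "the (\<nu> B) = the (\<nu> (B \<inter> A')) + the (\<nu> (B \<inter> B'))"
      using AB AB' h by (intro split') auto
    moreover have "the (\<mu> A') = the (\<mu> (A' \<inter> A)) + the (\<mu> (A' \<inter> B))"
      using AB AB' h by (intro split) auto
    moreover have "the (\<nu> B') = the (\<nu> (B' \<inter> A)) + the (\<nu> (B' \<inter> B))"
      using AB AB' h by (intro split') auto
    ultimately show ?thesis
      using 1 2 unfolding AB(5) AB'(5) by (simp add: Int_commute ac_simps)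
  qed
  have val: "the (\<rho> (A \<union> B)) = the (\<mu> A) + the (\<nu> B)"
    if "A \<in> dom \<mu>" "B \<in> dom \<nu>" "A \<inter> B = {}" for A B
  proof -
    have "P (A \<union> B) (the (\<mu> A) + the (\<nu> B))" using that unfolding P_def by blast
    then have "(THE x. P (A \<union> B) x) = the (\<mu> A) + the (\<nu> B)" using uniq by (intro the_equality)
    moreover have "A \<union> B \<in> D" using that unfolding D_def by blast
    ultimately show ?thesis by (simp add: \<rho>_def)
  qed
  have empty: "{} \<in> dom \<mu>" "{} \<in> dom \<nu>"
    using \<mu> \<nu> by (simp_all add: premeasure_delta_ring delta_ring_empty)
  have DI: "A \<union> B \<in> D" if "A \<in> dom \<mu>" "B \<in> dom \<nu>" for A B
    using that unfolding D_def by blast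
  have \<mu>D: "dom \<mu> \<subseteq> D" using DI[OF _ empty(2)] by auto
  have \<nu>D: "dom \<nu> \<subseteq> D" using DI[OF empty(1)] by auto
  have Dhost: "D \<subseteq> host \<mu>"
    using sub sigma_ring_Un[OF sigma_ring_host[of \<mu>]] by (auto simp: D_def)
  have ring: "delta_ring D"
  proof (rule delta_ring_ideal[OF sigma_ring_host[of \<mu>] Dhost])
    show "D \<noteq> {}" using empty \<mu>D by auto
    fix X Y assume "X \<in> D"
    then obtain A B where X: "A \<in> dom \<mu>" "B \<in> dom \<nu>" "X = A \<union> B" by (auto simp: D_def)
    { assume "Y \<in> D"
      then obtain A' B' where "A' \<in> dom \<mu>" "B' \<in> dom \<nu>" "Y = A' \<union> B'" by (auto simp: D_def)
      then have "A \<union> A' \<in> dom \<mu>" "B \<union> B' \<in> dom \<nu>" "X \<union> Y = (A \<union> A') \<union> (B \<union> B')"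
        using X delta_ring_Un[OF premeasure_delta_ring[OF \<mu>]]
          delta_ring_Un[OF premeasure_delta_ring[OF \<nu>]] by auto
      then show "X \<union> Y \<in> D" using DI by metis }
    { assume "Y \<in> host \<mu>"
      then have "A \<inter> Y \<in> dom \<mu>" "B \<inter> Y \<in> dom \<nu>" "X \<inter> Y = (A \<inter> Y) \<union> (B \<inter> Y)"
        using X \<mu>Int \<nu>Int by auto
      then show "X \<inter> Y \<in> D" using DI by metis }
  qed
  have pre: "premeasure \<rho>"
  proof (rule premeasureI, unfold dom)
    show "delta_ring D" by (rule ring)
    fix I :: "nat set" and C
    assume C: "C ` I \<subseteq> D" "disjoint_family_on C I" "(\<Union>i\<in>I. C i) \<in> D"
    then obtain A B\<^sub>0 where A: "A \<in> dom \<mu>" and "B\<^sub>0 \<in> dom \<nu>" "(\<Union>i\<in>I. C i) = A \<union> B\<^sub>0"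
      by (auto simp: D_def)
    \<comment> \<open>Removing \<open>A\<close> makes the decomposition disjoint; the ideal property
      keeps the remainder in \<open>dom \<nu>\<close>.\<close>
    moreover define B where "B = B\<^sub>0 - A"
    moreover from calculation have "B \<in> host \<nu>"
      using sub unfolding host B_def by (intro sigma_ring_Diff[OF sigma_ring_host]) auto
    ultimately have B: "B \<in> dom \<nu>" "(\<Union>i\<in>I. C i) = A \<union> B" "A \<inter> B = {}"
      using premeasure_subset_mem[OF \<nu>, of B\<^sub>0 B] by (simp_all add: B_def Int_Diff)
    have Ci: "A \<inter> C i \<in> dom \<mu>" "B \<inter> C i \<in> dom \<nu>" "(A \<inter> C i) \<inter> (B \<inter> C i) = {}"
      "(A \<inter> C i) \<union> (B \<inter> C i) = C i" if "i \<in> I" for i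
    proof -
      have "C i \<in> host \<mu>" using that C(1) Dhost by blast
      then show "A \<inter> C i \<in> dom \<mu>" "B \<inter> C i \<in> dom \<nu>" using A B(1) \<mu>Int \<nu>Int by metis+
      show "(A \<inter> C i) \<inter> (B \<inter> C i) = {}" using B(3) by blast
      show "(A \<inter> C i) \<union> (B \<inter> C i) = C i" using B(2) that by blast
    qed
    \<comment> \<open>Intersecting with \<open>A\<close> and with \<open>B\<close> yields partitions
      inside \<open>dom \<mu>\<close> and \<open>dom \<nu>\<close> over the same index set. Their
      sums add termwise because addition is continuous.\<close>
    have "disjoint_family_on (\<lambda>i. X \<inter> C i) I" for X
      using C(2) unfolding disjoint_family_on_def by blast
    moreover have "(\<Union>i\<in>I. A \<inter> C i) = A" "(\<Union>i\<in>I. B \<inter> C i) = B" using B(2) by blast+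
    ultimately have
      "((\<lambda>i. the (\<mu> (A \<inter> C i)) + the (\<nu> (B \<inter> C i))) has_sum the (\<mu> A) + the (\<nu> B)) I"
      using A B(1) Ci(1,2) by (intro has_sum_add premeasure_has_sum \<mu> \<nu> image_subsetI)
    moreover have "the (\<rho> (C i)) = the (\<mu> (A \<inter> C i)) + the (\<nu> (B \<inter> C i))" if "i \<in> I" for i
      using val[of "A \<inter> C i" "B \<inter> C i"] Ci[OF that] by simp
    ultimately show "((\<lambda>i. the (\<rho> (C i))) has_sum the (\<rho> (\<Union>i\<in>I. C i))) I"
      unfolding B(2) val[OF A B(1,3)] by (simp cong: has_sum_cong)
  qed
  \<comment> \<open>Pairing a set with \<open>{}\<close>, where both maps vanish, shows that \<rho>
    extends \<mu> and \<nu>.\<close>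
  have zero: "the (\<mu> {}) = 0" "the (\<nu> {}) = 0"
    using premeasure_empty \<mu> \<nu> by auto
  have "\<mu> \<subseteq>\<^sub>m \<rho>"
    unfolding map_le_def
  proof
    fix A assume "A \<in> dom \<mu>"
    moreover from this have "the (\<rho> A) = the (\<mu> A)" using val[of A "{}"] empty zero by simp
    ultimately show "\<mu> A = \<rho> A" using dom \<mu>D by (metis domIff option.expand subsetD)
  qed
  moreover have "\<nu> \<subseteq>\<^sub>m \<rho>"
    unfolding map_le_def
  proof
    fix A assume "A \<in> dom \<nu>"
    moreover from this have "the (\<rho> A) = the (\<nu> A)" using val[of "{}" A] empty zero by simp
    ultimately show "\<nu> A = \<rho> A" using dom \<nu>D by (metis domIff option.expand subsetD)
  qed
  moreover have "host \<rho> = host \<mu>"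
    using host_subset_mono[of \<rho> \<mu>] host_subset_mono[of \<mu> \<rho>] dom Dhost \<mu>D dom_subset_host[of \<rho>]
    by blast
  ultimately show thesis using that pre by blast
qed

section \<open>The induced measure\<close>

text \<open>Premeasures similar to \<mu> agree pairwise by transitivity, so their union
  \<open>U\<close> is a function. Once \<open>U\<close> is known to be a premeasure similar to
  \<mu>, anything similar to \<open>U\<close> is similar to \<mu> and hence already part of the
  union; this is maximality.\<close>

lemma maximal_measure_exists:
  assumes \<mu>: "premeasure \<mu>"
  shows "\<exists>\<nu>. maximal_measure \<nu> \<and> \<nu> \<asymp> \<mu>"
proof -
  define P where "P \<nu> \<longleftrightarrow> premeasure \<nu> \<and> \<nu> \<asymp> \<mu>" for \<nu>
  \<comment> \<open>Any member of the family defined at \<open>A\<close> may be chosen;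
    \<open>ext\<close> shows that the choice is immaterial.\<close>
  define U where "U A = (if \<exists>\<nu>. P \<nu> \<and> A \<in> dom \<nu> then (SOME \<nu>. P \<nu> \<and> A \<in> dom \<nu>) A else None)" for A
  have PP: "\<nu> \<asymp> \<rho>" if "P \<nu>" "P \<rho>" for \<nu> \<rho>
    using that similar_trans[of \<nu> \<mu> \<rho>] similar_sym \<mu> by (auto simp: P_def)
  have host: "host \<nu> = host \<mu>" if "P \<nu>" for \<nu>
    using that similar_host by (auto simp: P_def)
  have pre: "premeasure \<nu>" if "P \<nu>" for \<nu> using that by (simp add: P_def)
  have ext: "\<nu> \<subseteq>\<^sub>m U" if "P \<nu>" for \<nu>
    unfolding map_le_def
  proof
    fix A assume "A \<in> dom \<nu>"
    with that have *: "P \<nu> \<and> A \<in> dom \<nu>" by simp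
    let ?\<rho> = "SOME \<nu>. P \<nu> \<and> A \<in> dom \<nu>"
    have "P ?\<rho> \<and> A \<in> dom ?\<rho>" using someI[of "\<lambda>\<nu>. P \<nu> \<and> A \<in> dom \<nu>", OF *] .
    then have "\<nu> A = ?\<rho> A" using * similar_eq PP by metis
    then show "\<nu> A = U A" using * unfolding U_def by auto
  qed
  have dom: "A \<in> dom U \<longleftrightarrow> (\<exists>\<nu>. P \<nu> \<and> A \<in> dom \<nu>)" for A
  proof
    show "A \<in> dom U \<Longrightarrow> \<exists>\<nu>. P \<nu> \<and> A \<in> dom \<nu>"
      unfolding domIff U_def by presburger
    show "\<exists>\<nu>. P \<nu> \<and> A \<in> dom \<nu> \<Longrightarrow> A \<in> dom U"
      by (elim exE conjE) (rule subsetD[OF map_le_implies_dom_le[OF ext]])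
  qed
  have P\<mu>: "P \<mu>" using \<mu> by (simp add: P_def similar_refl)
  have Uhost: "dom U \<subseteq> host \<mu>"
  proof
    fix A assume "A \<in> dom U"
    then obtain \<nu> where "P \<nu>" "A \<in> dom \<nu>" using dom by blast
    then show "A \<in> host \<mu>" using dom_subset_host[of \<nu>] host[of \<nu>] by auto
  qed
  have ring: "delta_ring (dom U)"
  proof (rule delta_ring_ideal[OF sigma_ring_host[of \<mu>] Uhost])
    have "{} \<in> dom U"
      unfolding dom using P\<mu> delta_ring_empty[OF premeasure_delta_ring[OF \<mu>]] by metis
    then show "dom U \<noteq> {}" by (metis empty_iff)
    fix A B assume "A \<in> dom U"
    then obtain \<nu> where \<nu>: "P \<nu>" "A \<in> dom \<nu>" using dom by blast
    { assume "B \<in> host \<mu>"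
      then have "A \<inter> B \<in> dom \<nu>"
        by (intro premeasure_Int[OF pre[OF \<nu>(1)] \<nu>(2)]) (simp add: host[OF \<nu>(1)])
      then show "A \<inter> B \<in> dom U" using \<nu>(1) dom by blast }
    \<comment> \<open>The sets \<open>A\<close> and \<open>B\<close> may come from different members
      \<nu> and \<rho>. A joint extension of these is again similar to \<mu>, and its domain
      contains the union.\<close>
    { assume "B \<in> dom U"
      then obtain \<rho> where \<rho>: "P \<rho>" "B \<in> dom \<rho>" using dom by blast
      obtain \<tau> where \<tau>: "premeasure \<tau>" "\<nu> \<subseteq>\<^sub>m \<tau>" "\<rho> \<subseteq>\<^sub>m \<tau>" "host \<tau> = host \<nu>"
        using premeasure_join[OF pre[OF \<nu>(1)] pre[OF \<rho>(1)] PP[OF \<nu>(1) \<rho>(1)]] .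
      have "\<tau> \<asymp> \<nu>" by (rule similar_sym[OF similar_map_le[OF \<tau>(2) \<tau>(4)[symmetric]]])
      then have "P \<tau>"
        using similar_trans[OF \<tau>(1) pre[OF \<nu>(1)] \<mu>] \<tau>(1) \<nu>(1) by (simp add: P_def)
      moreover have "A \<in> dom \<tau>" "B \<in> dom \<tau>"
        using \<nu>(2) \<rho>(2) map_le_implies_dom_le[OF \<tau>(2)] map_le_implies_dom_le[OF \<tau>(3)] by auto
      then have "A \<union> B \<in> dom \<tau>" by (intro delta_ring_Un premeasure_delta_ring \<tau>)
      ultimately show "A \<union> B \<in> dom U" using dom by blast }
  qed
  have preU: "premeasure U"
  proof (rule premeasureI[OF ring])
    fix I :: "nat set" and A
    assume A: "A ` I \<subseteq> dom U" "disjoint_family_on A I" "(\<Union>i\<in>I. A i) \<in> dom U"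
    then obtain \<nu> where \<nu>: "P \<nu>" "(\<Union>i\<in>I. A i) \<in> dom \<nu>" using dom by blast
    \<comment> \<open>A single \<nu> defined at the union is defined at every member, since each is
      a subset belonging to the host. Countable additivity of \<open>U\<close> on this partition is
      thus that of \<nu>.\<close>
    have Ai: "A i \<in> dom \<nu>" if "i \<in> I" for i
      using that A(1) Uhost \<nu> by (intro premeasure_subset_mem[OF pre[OF \<nu>(1)] \<nu>(2)]) (auto simp: host)
    have eq: "U X = \<nu> X" if "X \<in> dom \<nu>" for X
      using that ext[OF \<nu>(1)] by (simp add: map_le_def)
    have "((\<lambda>i. the (\<nu> (A i))) has_sum the (\<nu> (\<Union>i\<in>I. A i))) I"
      using Ai A(2) \<nu> by (intro premeasure_has_sum pre) auto
    then show "((\<lambda>i. the (U (A i))) has_sum the (U (\<Union>i\<in>I. A i))) I"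
      unfolding eq[OF \<nu>(2)] using Ai by (simp add: eq cong: has_sum_cong)
  qed
  have hostU: "host U = host \<mu>"
    using host_subset_mono[of U \<mu>] host_subset_mono[of \<mu> U] Uhost dom_subset_host[of U]
      map_le_implies_dom_le[OF ext[OF P\<mu>]] by blast
  have sim: "U \<asymp> \<mu>" by (rule similar_sym[OF similar_map_le[OF ext[OF P\<mu>] hostU[symmetric]]])
  have "\<nu> \<subseteq>\<^sub>m U" if "premeasure \<nu>" "\<nu> \<asymp> U" for \<nu>
    using that similar_trans[OF that(1) preU \<mu> that(2) sim] by (intro ext) (simp add: P_def)
  then show ?thesis using preU sim unfolding maximal_measure_def by blast
qed

text \<open>By transitivity the two measures are similar to each other, so maximality makes each an
  extension of the other.\<close>

lemma maximal_measure_unique: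
  assumes "premeasure \<mu>" "maximal_measure \<nu>" "\<nu> \<asymp> \<mu>" "maximal_measure \<rho>" "\<rho> \<asymp> \<mu>"
  shows "\<nu> = \<rho>"
proof -
  have "\<nu> \<asymp> \<rho>"
    using assms similar_trans[of \<nu> \<mu> \<rho>] similar_sym unfolding maximal_measure_def by blast
  then show ?thesis
    using assms similar_sym unfolding maximal_measure_def by (meson map_le_antisym)
qed

lemma induced_measure_eqI:
  "premeasure \<mu> \<Longrightarrow> maximal_measure \<nu> \<Longrightarrow> \<nu> \<asymp> \<mu> \<Longrightarrow> induced_measure \<mu> = \<nu>"
  unfolding induced_measure_def by (blast intro: maximal_measure_unique)

lemma
  assumes "premeasure \<mu>"
  shows maximal_induced_measure: "maximal_measure (induced_measure \<mu>)"
    and induced_measure_similar: "induced_measure \<mu> \<asymp> \<mu>"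
proof -
  have "maximal_measure (induced_measure \<mu>) \<and> induced_measure \<mu> \<asymp> \<mu>"
    using maximal_measure_exists[OF assms] induced_measure_eqI[OF assms] by auto
  then show "maximal_measure (induced_measure \<mu>)" "induced_measure \<mu> \<asymp> \<mu>" by auto
qed

lemma similar_induced_measure: "premeasure \<mu> \<Longrightarrow> \<mu> \<asymp> induced_measure \<mu>"
  by (rule similar_sym[OF induced_measure_similar])

lemma maximal_measure_premeasure: "maximal_measure \<mu> \<Longrightarrow> premeasure \<mu>"
  by (simp add: maximal_measure_def)

lemma premeasure_induced_measure: "premeasure \<mu> \<Longrightarrow> premeasure (induced_measure \<mu>)"
  by (simp add: maximal_measure_premeasure maximal_induced_measure)

lemma induced_measure_extends: "premeasure \<mu> \<Longrightarrow> \<mu> \<subseteq>\<^sub>m induced_measure \<mu>"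
  using maximal_induced_measure induced_measure_similar similar_sym
  unfolding maximal_measure_def by blast

lemma host_induced_measure: "premeasure \<mu> \<Longrightarrow> host (induced_measure \<mu>) = host \<mu>"
  using induced_measure_similar similar_host by blast

text \<open>The induced measure depends only on the similarity class; identities for sums and
  multiples thereby reduce to similarities.\<close>

lemma induced_measure_cong:
  assumes "premeasure \<mu>" "premeasure \<nu>" "\<mu> \<asymp> \<nu>"
  shows "induced_measure \<mu> = induced_measure \<nu>"
  by (intro induced_measure_eqI maximal_induced_measure assms(1,2)
      similar_trans[OF premeasure_induced_measure[OF assms(2)] assms(2,1)]
      induced_measure_similar similar_sym[OF assms(3)])

section \<open>Compatibility of the induced measure with sums, multiples, zero and
  restriction\<close>

lemma induced_measure_pointwise_add:
  assumes "premeasure \<mu>" "premeasure \<nu>" "host \<mu> = host \<nu>"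
  shows "induced_measure (pointwise_add \<mu> \<nu>) =
    induced_measure (pointwise_add (induced_measure \<mu>) (induced_measure \<nu>))"
  using assms
  by (intro induced_measure_cong similar_pointwise_add premeasure_pointwise_add)
    (auto simp: premeasure_induced_measure host_induced_measure similar_induced_measure)

lemma (in hclm) induced_measure_pointwise_scale:
  assumes "k \<in> \<K>" "premeasure \<mu>"
  shows "induced_measure (pointwise_scale sc k \<mu>) = measure_scale sc k (induced_measure \<mu>)"
  unfolding measure_scale_def using assms
  by (intro induced_measure_cong similar_pointwise_scale premeasure_pointwise_scale)
    (auto simp: premeasure_induced_measure similar_induced_measure)

text \<open>The zero map on the whole \<sigma>-ring is maximal: the domain of anything similar to it
  lies in the host, which is already its own domain.\<close>

lemma induced_measure_zero_on:
  fixes K :: "'s set set"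
  assumes "delta_ring K"
  shows "induced_measure (zero_on K) =
    (zero_on (sigma_ring_gen K) :: 's set \<rightharpoonup> 'a::{topological_comm_monoid_add, t2_space})"
proof (rule induced_measure_eqI[OF premeasure_zero_on[OF assms]])
  let ?Q = "sigma_ring_gen K"
  let ?z = "zero_on ?Q :: 's set \<rightharpoonup> 'a"
  have Q: "sigma_ring ?Q" by (rule sigma_ring_gen_least)
  have host: "host ?z = ?Q" by (simp add: host_def dom_zero_on sigma_ring_gen_idem[OF Q])
  have "\<nu> \<subseteq>\<^sub>m ?z" if "\<nu> \<asymp> ?z" for \<nu> :: "'s set \<rightharpoonup> 'a"
    using that dom_subset_host[of \<nu>] host unfolding map_le_def similar_def dom_zero_on by blast
  then show "maximal_measure ?z"
    unfolding maximal_measure_def using premeasure_zero_on[OF sigma_ring_imp_delta_ring[OF Q]] by blast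
  have "zero_on K \<subseteq>\<^sub>m ?z"
    using sigma_ring_gen_least(2)[of K] by (auto simp: map_le_def zero_on_def)
  then show "?z \<asymp> zero_on K"
    by (intro similar_map_le[THEN similar_sym]) (simp_all add: host host_def[of "zero_on K"] dom_zero_on)
qed

text \<open>Provides preimages for the description of the image. Since \<open>K\<close> generates
  the host of \<mu>, restricting to \<open>K\<close> stays within the similarity class, and \<mu> is
  the measure in that class.\<close>

lemma induced_measure_restrict:
  assumes \<mu>: "maximal_measure \<mu>" and K: "delta_ring K" "K \<subseteq> dom \<mu>" "sigma_ring_gen K = host \<mu>"
  shows "induced_measure (\<mu> |` K) = \<mu>"
proof (rule induced_measure_eqI[OF _ \<mu>])
  show "premeasure (\<mu> |` K)"
    using K maximal_measure_premeasure[OF \<mu>] by (intro premeasure_restrict)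
  have "dom (\<mu> |` K) = K" using K(2) by auto
  then show "\<mu> \<asymp> \<mu> |` K"
    using K(3) by (intro similar_map_le[THEN similar_sym]) (auto simp: map_le_def host_def)
qed

section \<open>The order: passage from terms to series and from premeasures to measures\<close>

lemma (in hotm) leq_add: "leq a b \<Longrightarrow> leq c d \<Longrightarrow> leq (a + c) (b + d)"
  using le_add_right[of a b c] le_add_right[of c d b] transpD[OF le_trans]
  by (metis add.commute)

text \<open>Series are limits of sequences of partial sums, so sequential closedness of the order
  relation is enough to pass to the limit.\<close>

lemma (in hotm) leq_sums:
  assumes "f sums a" "g sums b" "\<And>n. leq (f n) (g n)"
  shows "leq a b"
proof -
  have "leq (\<Sum>i<n. f i) (\<Sum>i<n. g i)" for n
    by (induction n) (auto intro: leq_add assms(3) reflpD[OF le_refl])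
  moreover have "(\<lambda>n. (\<Sum>i<n. f i, \<Sum>i<n. g i)) \<longlonglongrightarrow> (a, b)"
    using assms(1,2) unfolding sums_def by (rule tendsto_Pair)
  ultimately show ?thesis
    using le_seq_closed[of "\<lambda>n. (\<Sum>i<n. f i, \<Sum>i<n. g i)" "(a, b)"] by simp
qed

lemma (in hotm) pointwise_le_induced_measure_iff:
  assumes \<mu>: "premeasure \<mu>" and \<nu>: "premeasure \<nu>" and dom: "dom \<mu> = K" "dom \<nu> = K"
  shows "pointwise_le leq (induced_measure \<mu>) (induced_measure \<nu>) \<longleftrightarrow> pointwise_le leq \<mu> \<nu>"
proof -
  let ?\<mu> = "induced_measure \<mu>" and ?\<nu> = "induced_measure \<nu>"
  have eq: "?\<mu> A = \<mu> A" "?\<nu> A = \<nu> A" if "A \<in> K" for A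
    using that induced_measure_extends[OF \<mu>] induced_measure_extends[OF \<nu>] dom
    by (simp_all add: map_le_def)
  have sub: "K \<subseteq> dom ?\<mu>" "K \<subseteq> dom ?\<nu>"
    using map_le_implies_dom_le[OF induced_measure_extends] \<mu> \<nu> dom by blast+
  show ?thesis
  proof
    assume le: "pointwise_le leq ?\<mu> ?\<nu>"
    have "leq (the (\<mu> A)) (the (\<nu> A))" if "A \<in> K" for A
    proof -
      have "A \<in> dom ?\<mu> \<inter> dom ?\<nu>" using that sub by blast
      then have "leq (the (?\<mu> A)) (the (?\<nu> A))" using le unfolding pointwise_le_def by blast
      then show ?thesis by (simp only: eq[OF that])
    qed
    then show "pointwise_le leq \<mu> \<nu>" by (simp add: pointwise_le_def dom)
  next
    assume le: "pointwise_le leq \<mu> \<nu>"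
    show "pointwise_le leq ?\<mu> ?\<nu>"
      unfolding pointwise_le_def
    proof
      fix S assume S: "S \<in> dom ?\<mu> \<inter> dom ?\<nu>"
      then have "S \<in> sigma_ring_gen K"
        using dom_subset_host[of ?\<mu>] host_induced_measure[OF \<mu>] dom(1)
        by (auto simp: host_def[of \<mu>])
      \<comment> \<open>The inequality is known only on \<open>K\<close>, so \<open>S\<close> is cut
        into countably many pieces from \<open>K\<close>. Unordered sums over the pieces are then
        read as series in order to apply \<open>leq_sums\<close>.\<close>
      then obtain A :: "nat \<Rightarrow> _" where A: "range A \<subseteq> K" "disjoint_family A" "(\<Union>n. A n) = S"
        using delta_ring_disjoint_cover premeasure_delta_ring[OF \<mu>] dom(1) by metis
      have An: "A n \<in> K" for n using A(1) by auto
      have "((\<lambda>n. the (?\<mu> (A n))) has_sum the (?\<mu> S)) UNIV"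
        using A S sub by (intro premeasure_has_sum premeasure_induced_measure \<mu>) auto
      then have "(\<lambda>n. the (\<mu> (A n))) sums the (?\<mu> S)"
        using An eq has_sum_imp_sums by simp
      moreover have "((\<lambda>n. the (?\<nu> (A n))) has_sum the (?\<nu> S)) UNIV"
        using A S sub by (intro premeasure_has_sum premeasure_induced_measure \<nu>) auto
      then have "(\<lambda>n. the (\<nu> (A n))) sums the (?\<nu> S)"
        using An eq has_sum_imp_sums by simp
      moreover have "leq (the (\<mu> (A n))) (the (\<nu> (A n)))" for n
        using le An dom by (simp add: pointwise_le_def)
      ultimately show "leq (the (?\<mu> S)) (the (?\<nu> S))" by (rule leq_sums)
    qed
  qed
qed

section \<open>The embedding of premeasures on \<open>K\<close> into the measures on
  \<sigma>(K)\<close>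

theorem proposition7p19:
  fixes K Q :: "'s set set"
    and f :: "('s set \<rightharpoonup> 'a::{topological_comm_monoid_add, t2_space}) \<Rightarrow> ('s set \<rightharpoonup> 'a)"
    and \<K> :: "'k set" and sc :: "'k \<Rightarrow> 'a \<Rightarrow> 'a"
    and leq :: "'a \<Rightarrow> 'a \<Rightarrow> bool"
  assumes "delta_ring K"
    and "Q = sigma_ring_gen K"
    and "\<And>\<mu>. \<mu> \<in> carrier (premeasure_monoid K) \<Longrightarrow> f \<mu> = induced_measure \<mu>"
  shows "f \<in> monoid_hom (premeasure_monoid K) (measure_monoid Q) \<and>
    inj_on f (carrier (premeasure_monoid K)) \<and>
    f ` carrier (premeasure_monoid K) = {\<mu> \<in> carrier (measure_monoid Q). K \<subseteq> dom \<mu>} \<and>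
    (hclm \<K> sc \<longrightarrow>
      (\<forall>k\<in>\<K>. \<forall>\<mu>\<in>carrier (premeasure_monoid K).
        f (pointwise_scale sc k \<mu>) = measure_scale sc k (f \<mu>))) \<and>
    (hotm leq \<longrightarrow>
      (\<forall>\<mu>\<in>carrier (premeasure_monoid K). \<forall>\<nu>\<in>carrier (premeasure_monoid K).
        pointwise_le leq (f \<mu>) (f \<nu>) \<longleftrightarrow> pointwise_le leq \<mu> \<nu>))"
proof -
  note K = assms(1) and Q = assms(2)
  let ?M = "premeasure_monoid K :: ('s set \<rightharpoonup> 'a) monoid"
  let ?N = "measure_monoid Q :: ('s set \<rightharpoonup> 'a) monoid"
  have M: "\<mu> \<in> carrier ?M \<longleftrightarrow> premeasure \<mu> \<and> dom \<mu> = K" for \<mu>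
    by (simp add: premeasure_monoid_def)
  have N: "\<mu> \<in> carrier ?N \<longleftrightarrow> maximal_measure \<mu> \<and> host \<mu> = Q" for \<mu>
    by (simp add: measure_monoid_def)
  \<comment> \<open>The map \<open>f\<close> is specified only on premeasures with domain
    \<open>K\<close>, so sums, multiples and restrictions must be shown to be such before
    \<open>f\<close> can be evaluated at them.\<close>
  have f: "f \<mu> = induced_measure \<mu>" if "premeasure \<mu>" "dom \<mu> = K" for \<mu>
    using that assms(3) by (simp add: M)
  have host: "host \<mu> = Q" if "dom \<mu> = K" for \<mu> :: "'s set \<rightharpoonup> 'a"
    using that Q by (simp add: host_def)
  have fN: "f \<mu> \<in> carrier ?N" if "\<mu> \<in> carrier ?M" for \<mu>
    using that by (simp add: M N f maximal_induced_measure host_induced_measure host)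
  have ext: "\<mu> \<subseteq>\<^sub>m f \<mu>" if "\<mu> \<in> carrier ?M" for \<mu>
    using that by (simp add: M f induced_measure_extends)
  have "f \<in> monoid_hom ?M ?N"
    unfolding monoid_hom_def
  proof (intro CollectI conjI homI)
    fix \<mu> \<nu> assume "\<mu> \<in> carrier ?M" "\<nu> \<in> carrier ?M"
    then have *: "premeasure \<mu>" "premeasure \<nu>" "dom \<mu> = K" "dom \<nu> = K" by (auto simp: M)
    then have "premeasure (pointwise_add \<mu> \<nu>)" by (simp add: premeasure_pointwise_add host)
    with * show "f (\<mu> \<otimes>\<^bsub>?M\<^esub> \<nu>) = f \<mu> \<otimes>\<^bsub>?N\<^esub> f \<nu>"
      by (simp add: premeasure_monoid_def measure_monoid_def f dom_pointwise_add host
          flip: induced_measure_pointwise_add)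
  next
    show "f \<one>\<^bsub>?M\<^esub> = \<one>\<^bsub>?N\<^esub>"
      using K by (simp add: premeasure_monoid_def measure_monoid_def f premeasure_zero_on
          dom_zero_on induced_measure_zero_on Q)
  qed (rule fN)
  moreover have "inj_on f (carrier ?M)"
  proof (rule inj_onI)
    fix \<mu> \<nu> assume *: "\<mu> \<in> carrier ?M" "\<nu> \<in> carrier ?M" "f \<mu> = f \<nu>"
    \<comment> \<open>On \<open>K\<close> both maps agree with their common image under
      \<open>f\<close>, which extends them; off \<open>K\<close> both are
      \<open>None\<close>.\<close>
    show "\<mu> = \<nu>"
    proof
      fix A show "\<mu> A = \<nu> A"
        using * ext[OF *(1)] ext[OF *(2)] unfolding map_le_def M by (metis domIff)
    qed
  qed
  moreover have "f ` carrier ?M = {\<mu> \<in> carrier ?N. K \<subseteq> dom \<mu>}"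
  proof (intro equalityI subsetI)
    fix \<nu> assume "\<nu> \<in> f ` carrier ?M"
    then obtain \<mu> where \<mu>: "\<mu> \<in> carrier ?M" and "\<nu> = f \<mu>" by blast
    moreover have "K \<subseteq> dom (f \<mu>)"
      using map_le_implies_dom_le[OF ext[OF \<mu>]] \<mu> by (simp add: M)
    ultimately show "\<nu> \<in> {\<nu> \<in> carrier ?N. K \<subseteq> dom \<nu>}" using fN by blast
  next
    fix \<mu> assume "\<mu> \<in> {\<mu> \<in> carrier ?N. K \<subseteq> dom \<mu>}"
    then have *: "maximal_measure \<mu>" "host \<mu> = Q" "K \<subseteq> dom \<mu>" by (auto simp: N)
    \<comment> \<open>The preimage of a measure defined on \<open>K\<close> is its restriction to
      \<open>K\<close>.\<close>
    then have **: "premeasure (\<mu> |` K)" "dom (\<mu> |` K) = K"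
      using K by (auto intro: premeasure_restrict maximal_measure_premeasure)
    then have "f (\<mu> |` K) = \<mu>"
      using * K Q by (simp add: f induced_measure_restrict)
    with ** show "\<mu> \<in> f ` carrier ?M" by (metis M imageI)
  qed
  moreover have "f (pointwise_scale sc k \<mu>) = measure_scale sc k (f \<mu>)"
    if "hclm \<K> sc" "k \<in> \<K>" "\<mu> \<in> carrier ?M" for k \<mu>
    using that by (simp add: M f dom_pointwise_scale hclm.premeasure_pointwise_scale
        hclm.induced_measure_pointwise_scale)
  moreover have "pointwise_le leq (f \<mu>) (f \<nu>) \<longleftrightarrow> pointwise_le leq \<mu> \<nu>"
    if "hotm leq" "\<mu> \<in> carrier ?M" "\<nu> \<in> carrier ?M" for \<mu> \<nu>
    using that by (simp add: M f hotm.pointwise_le_induced_measure_iff)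
  ultimately show ?thesis by blast
qed

end
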